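(* Every $K_5$-free graph $G$ on $n$ vertices contains a triangle-free induced subgraph on at least $n^{5/12}/2$ vertices.
   Context: A graph is $K_5$-free if it contains no complete graph on $5$ vertices as a subgraph; it is triangle-free if it contains no $K_3$. *)

theory Defs
  imports Complex_Main "Graph_Theory.Kuratowski"
begin

text \<open>
  Finite simple graphs are the symmetric, loop-free digraphs without parallel arcs of the locale
  \<^locale>\<open>graph\<close>; each undirected edge is represented by its two opposite arcs. Under this encoding
  \<^const>\<open>complete_digraph\<close> \<open>k\<close> recognises the complete (undirected) graphs on exactly \<open>k\<close> vertices.
\<close>

definition complete_free :: "nat \<Rightarrow> ('a, 'b) pre_digraph \<Rightarrow> bool" where
  "complete_free k G \<longleftrightarrow> \<not> (\<exists>H. subgraph H G \<and> complete_digraph k H)"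

abbreviation triangle_free :: "('a, 'b) pre_digraph \<Rightarrow> bool" where
  "triangle_free G \<equiv> complete_free 3 G"

end

theory Submission
  imports Defs "HOL-Analysis.Convex"
begin

text \<open>
  Put \<open>n = y^12\<close> and suppose that every triangle-free vertex set has fewer than \<open>M = y^5 / 2\<close> vertices.
  The common neighbourhood of an edge is triangle-free, as \<open>G\<close> has no \<open>K\<^sub>5\<close>, so every edge lies in
  fewer than \<open>M\<close> triangles. If the average degree is at most \<open>y^9\<close>, there are at most \<open>y^26 / 4\<close>
  triangles, and deleting a vertex from each triangle in a random vertex set of density about
  \<open>1 / y^7\<close> leaves a set that is too large. Otherwise let \<open>U\<close> be the common neighbourhood of two random
  vertices. A vertex of degree \<open>d\<close> lands in \<open>U\<close> with probability \<open>(d / n)^2\<close>, but an edge only with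
  probability at most \<open>(M / n)^2\<close>, so \<open>U\<close> is large and sparse, and the deletion method yields an
  independent set of at least \<open>M\<close> vertices.
\<close>

section \<open>Averaging over random colourings and the deletion method\<close>

lemma exists_ge_average:
  fixes g :: "'i \<Rightarrow> real" and c :: real
  assumes "finite I" "I \<noteq> {}" "c * card I \<le> sum g I"
  shows "\<exists>i\<in>I. c \<le> g i"
proof (rule ccontr)
  assume "\<not> ?thesis"
  then have "sum g I < (\<Sum>i\<in>I. c)"
    using assms by (intro sum_strict_mono) (auto simp: not_le)
  with assms show False by (simp add: mult.commute)
qed

text \<open>Colours on \<open>S\<close> are forced and the others are free. After division by
  \<open>q ^ card V\<close>, the number of all colourings, this says that a random colouring puts
  all of \<open>S\<close> into class 0 with probability \<open>1 / q ^ card S\<close>.\<close>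

lemma card_PiE_vanishing:
  fixes q :: nat
  assumes "finite V" "S \<subseteq> V" "q \<ge> 1"
  shows "card {f \<in> V \<rightarrow>\<^sub>E {..<q}. \<forall>v\<in>S. f v = 0} * q ^ card S = q ^ card V"
proof -
  have "{f \<in> V \<rightarrow>\<^sub>E {..<q}. \<forall>v\<in>S. f v = 0} = (\<Pi>\<^sub>E v\<in>V. if v \<in> S then {0} else {..<q})"
  proof (intro equalityI subsetI)
    fix f assume "f \<in> (\<Pi>\<^sub>E v\<in>V. if v \<in> S then {0} else {..<q})"
    then have f: "f v \<in> (if v \<in> S then {0} else {..<q})" if "v \<in> V" for v
      using that by (auto simp: PiE_iff)
    have "f v < q" if "v \<in> V" for v
      using f[OF that] assms(3) by (simp split: if_splits)
    moreover have "f v = 0" if "v \<in> S" for v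
      using f[of v] that assms(2) by auto
    ultimately show "f \<in> {f \<in> V \<rightarrow>\<^sub>E {..<q}. \<forall>v\<in>S. f v = 0}"
      using \<open>f \<in> (\<Pi>\<^sub>E v\<in>V. if v \<in> S then {0} else {..<q})\<close> by (simp add: PiE_iff)
  qed (simp add: PiE_iff)
  then have "card {f \<in> V \<rightarrow>\<^sub>E {..<q}. \<forall>v\<in>S. f v = 0} = (\<Prod>v\<in>V. if v \<in> S then 1 else q)"
    using assms by (simp add: card_PiE if_distrib cong: if_cong)
  also have "\<dots> = (\<Prod>v\<in>V - S. q)"
    using assms by (intro prod.mono_neutral_cong_right) auto
  finally have "card {f \<in> V \<rightarrow>\<^sub>E {..<q}. \<forall>v\<in>S. f v = 0} = q ^ card (V - S)"
    by simp
  moreover have "card (V - S) + card S = card V"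
    using assms by (simp add: card_Diff_subset card_mono finite_subset)
  ultimately show ?thesis
    by (metis power_add)
qed

text \<open>Deleting one chosen element of every member of \<open>B\<close> destroys all of them;
  members may share their chosen element, so at most \<open>card B\<close> elements are
  lost.\<close>

lemma exists_transversal_deletion:
  assumes "finite W" "finite B" "{} \<notin> B" "\<And>S. S \<in> B \<Longrightarrow> S \<subseteq> W"
  shows "\<exists>W'\<subseteq>W. (\<forall>S\<in>B. \<not> S \<subseteq> W') \<and> card W \<le> card W' + card B"
proof -
  define h where "h = (\<lambda>S::'a set. SOME v. v \<in> S)"
  have h: "h S \<in> S" if "S \<in> B" for S
    using that assms(3) unfolding h_def by (metis all_not_in_conv someI_ex)
  have "card W - card (h ` B) \<le> card (W - h ` B)"
    using assms by (intro diff_card_le_card_Diff) auto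
  moreover have "card (h ` B) \<le> card B"
    using assms card_image_le by blast
  ultimately have "card W \<le> card (W - h ` B) + card B" by linarith
  then show ?thesis using h by (intro exI[of _ "W - h ` B"]) blast
qed

text \<open>
  Keep one class of a uniformly random \<open>q\<close>-colouring of \<open>V\<close> and delete a vertex from each member
  of \<open>F\<close> inside it.
\<close>
lemma sparse_family_free_subset:
  fixes q k :: nat
  assumes V: "finite V" and F: "\<And>S. S \<in> F \<Longrightarrow> S \<subseteq> V \<and> card S = k"
    and k: "k \<ge> 1" and q: "q \<ge> 1"
  shows "\<exists>W\<subseteq>V. (\<forall>S\<in>F. \<not> S \<subseteq> W) \<and> real (card V) / q - real (card F) / q ^ k \<le> card W"
proof -
  define \<Phi> where "\<Phi> = V \<rightarrow>\<^sub>E {..<q}"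
  define W where "W f = {v \<in> V. f v = 0}" for f :: "'a \<Rightarrow> nat"
  define B where "B f = {S \<in> F. S \<subseteq> W f}" for f
  have finF: "finite F"
    using F V by (meson finite_Pow_iff finite_subset PowI subsetI)
  have fin\<Phi>: "finite \<Phi>" and ne: "\<Phi> \<noteq> {}"
    using V q by (auto simp: \<Phi>_def finite_PiE PiE_eq_empty_iff lessThan_empty_iff)
  have card\<Phi>: "real (card \<Phi>) = real q ^ card V"
    using V by (simp add: \<Phi>_def card_PiE)
  have vanish: "real (card {f \<in> \<Phi>. \<forall>v\<in>S. f v = 0}) = card \<Phi> / q ^ card S" if "S \<subseteq> V" for S
  proof -
    have "real (card {f \<in> \<Phi>. \<forall>v\<in>S. f v = 0} * q ^ card S) = real (q ^ card V)"
      using card_PiE_vanishing[OF V that q] unfolding \<Phi>_def by simp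
    then show ?thesis using q card\<Phi> by (simp add: field_simps)
  qed
  \<comment> \<open>Both expectations come from double counting: pairs of a colouring and a vertex
    in its class 0 here, pairs of a colouring and a member of \<open>F\<close> inside that class
    below.\<close>
  have "(\<Sum>f\<in>\<Phi>. card (W f)) = (\<Sum>v\<in>V. card {f \<in> \<Phi>. f v = 0})"
    unfolding W_def using V fin\<Phi> by (intro sum_multicount_gen) auto
  then have "(\<Sum>f\<in>\<Phi>. real (card (W f))) = (\<Sum>v\<in>V. real (card {f \<in> \<Phi>. \<forall>u\<in>{v}. f u = 0}))"
    by (simp flip: of_nat_sum)
  also have "\<dots> = (\<Sum>v\<in>V. card \<Phi> / q)"
    by (intro sum.cong refl, subst vanish) auto
  finally have sumW: "(\<Sum>f\<in>\<Phi>. real (card (W f))) = card V * (card \<Phi> / q)"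
    by simp
  have "(\<Sum>f\<in>\<Phi>. card (B f)) = (\<Sum>S\<in>F. card {f \<in> \<Phi>. S \<subseteq> W f})"
    unfolding B_def using finF fin\<Phi> by (intro sum_multicount_gen) auto
  also have "\<dots> = (\<Sum>S\<in>F. card {f \<in> \<Phi>. \<forall>u\<in>S. f u = 0})"
    using F by (intro sum.cong refl arg_cong[of _ _ card]) (auto simp: W_def)
  finally have "(\<Sum>f\<in>\<Phi>. real (card (B f))) = (\<Sum>S\<in>F. real (card {f \<in> \<Phi>. \<forall>u\<in>S. f u = 0}))"
    by (simp flip: of_nat_sum)
  also have "\<dots> = (\<Sum>S\<in>F. card \<Phi> / q ^ k)"
    using F by (intro sum.cong refl) (simp add: vanish)
  finally have sumB: "(\<Sum>f\<in>\<Phi>. real (card (B f))) = card F * (card \<Phi> / q ^ k)"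
    by simp
  have "\<exists>f\<in>\<Phi>. real (card V) / q - real (card F) / q ^ k \<le> real (card (W f)) - real (card (B f))"
    by (rule exists_ge_average[OF fin\<Phi> ne])
      (simp add: sum_subtractf sumW sumB algebra_simps)
  then obtain f where f: "real (card V) / q - real (card F) / q ^ k \<le> real (card (W f)) - real (card (B f))"
    by blast
  \<comment> \<open>The empty set would survive every deletion; \<open>k \<ge> 1\<close> excludes
    it.\<close>
  have "{} \<notin> B f" using F[of "{}"] k by (auto simp: B_def)
  then obtain W' where W': "W' \<subseteq> W f" "\<forall>S\<in>B f. \<not> S \<subseteq> W'" "card (W f) \<le> card W' + card (B f)"
    using exists_transversal_deletion[of "W f" "B f"] V finF by (auto simp: B_def W_def)
  show ?thesis
  proof (intro exI conjI)
    show "W' \<subseteq> V" using W' by (auto simp: W_def)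
    show "\<forall>S\<in>F. \<not> S \<subseteq> W'" using W' by (auto simp: B_def)
    show "real (card V) / q - real (card F) / q ^ k \<le> card W'"
      using f W'(3) by linarith
  qed
qed

section \<open>Cliques, common neighbourhoods and counting\<close>

definition cliques :: "('a \<Rightarrow> 'a \<Rightarrow> bool) \<Rightarrow> 'a set \<Rightarrow> nat \<Rightarrow> 'a set set" where
  "cliques A V k = {K. K \<subseteq> V \<and> card K = k \<and> pairwise A K}"

text \<open>The relation \<open>A\<close> is not confined to \<open>V\<close>. An induced subgraph
  is thus a smaller vertex set with the same \<open>A\<close>, which is why \<open>cliques\<close>
  takes the vertex set as an argument.\<close>

locale adjacency =
  fixes V :: "'a set" and A :: "'a \<Rightarrow> 'a \<Rightarrow> bool"
  assumes finV: "finite V" and symA: "symp A" and irrA: "irreflp A"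
begin

definition common :: "'a set \<Rightarrow> 'a set" where
  "common S = {w \<in> V. \<forall>v\<in>S. A v w}"

lemma common_subset: "common S \<subseteq> V"
  by (auto simp: common_def)

lemma finite_common [simp]: "finite (common S)"
  using finV by (simp add: common_def)

lemma finite_cliques [simp]: "finite (cliques A V k)"
  using finV by (simp add: cliques_def)

lemma common_disjoint: "common S \<inter> S = {}"
  using irrA by (auto simp: common_def dest: irreflpD)

text \<open>Used with \<open>k = 2\<close> and \<open>l = 3\<close>: a triangle in the common
  neighbourhood of an edge completes it to a clique on 5 vertices.\<close>

lemma clique_Un_common:
  assumes "K \<in> cliques A V k" "L \<in> cliques A (common K) l" "k \<ge> 1" "l \<ge> 1"
  shows "K \<union> L \<in> cliques A V (k + l)"
proof -
  have "K \<inter> L = {}" using assms common_disjoint[of K] by (auto simp: cliques_def)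
  \<comment> \<open>Infinite sets have \<open>card\<close> 0, so positive sizes give
    finiteness.\<close>
  moreover have "finite K" "finite L"
    using assms by (auto simp: cliques_def intro: card_ge_0_finite)
  moreover have "pairwise A (K \<union> L)"
    using assms symA unfolding cliques_def common_def pairwise_def
    by (auto dest: sympD)
  ultimately show ?thesis
    using assms common_subset[of K] by (auto simp: cliques_def card_Un_disjoint)
qed

lemma clique_subset_exists:
  assumes "K \<in> cliques A W k" "l \<le> k"
  shows "\<exists>L\<subseteq>K. L \<in> cliques A W l"
proof -
  obtain L where "L \<subseteq> K" "card L = l"
    using assms obtain_subset_with_card_n[of l K] by (auto simp: cliques_def)
  then show ?thesis
    using assms by (auto simp: cliques_def intro: pairwise_subset)
qed

text \<open>Every triangle is an edge together with a common neighbour of its ends. Each triangle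
  arises from three edges, so a factor 3 is given away.\<close>

lemma card_triangles_le:
  fixes M :: real
  assumes "\<And>e. e \<in> cliques A V 2 \<Longrightarrow> card (common e) \<le> M"
  shows "real (card (cliques A V 3)) \<le> card (cliques A V 2) * M"
proof -
  have "cliques A V 3 \<subseteq> (\<Union>e\<in>cliques A V 2. (\<lambda>w. insert w e) ` common e)"
  proof
    fix K assume "K \<in> cliques A V 3"
    then have K: "K \<subseteq> V" "card K = 3" "pairwise A K" by (auto simp: cliques_def)
    then obtain a b c where abc: "K = {a, b, c}" "a \<noteq> b" "a \<noteq> c" "b \<noteq> c"
      by (auto simp: card_3_iff)
    then have "{a, b} \<in> cliques A V 2" "c \<in> common {a, b}" "K = insert c {a, b}"
      using K by (auto simp: cliques_def common_def pairwise_def)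
    then show "K \<in> (\<Union>e\<in>cliques A V 2. (\<lambda>w. insert w e) ` common e)" by blast
  qed
  then have "card (cliques A V 3) \<le> card (\<Union>e\<in>cliques A V 2. (\<lambda>w. insert w e) ` common e)"
    by (intro card_mono) auto
  also have "\<dots> \<le> (\<Sum>e\<in>cliques A V 2. card ((\<lambda>w. insert w e) ` common e))"
    by (rule card_UN_le) simp
  also have "\<dots> \<le> (\<Sum>e\<in>cliques A V 2. card (common e))"
    by (intro sum_mono card_image_le) simp
  finally have "real (card (cliques A V 3)) \<le> (\<Sum>e\<in>cliques A V 2. real (card (common e)))"
    by (simp flip: of_nat_sum)
  also have "\<dots> \<le> (\<Sum>e\<in>cliques A V 2. M)"
    by (intro sum_mono assms)
  finally show ?thesis by simp
qed

text \<open>The handshake lemma: neighbours of \<open>v\<close> correspond to edges through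
  \<open>v\<close>, and each edge has two ends.\<close>

lemma sum_degree: "(\<Sum>v\<in>V. card (common {v})) = 2 * card (cliques A V 2)"
proof -
  have "card (common {v}) = card {e \<in> cliques A V 2. v \<in> e}" if "v \<in> V" for v
  proof -
    have "{e \<in> cliques A V 2. v \<in> e} = (\<lambda>w. {v, w}) ` common {v}"
    proof (intro equalityI subsetI)
      fix e assume "e \<in> {e \<in> cliques A V 2. v \<in> e}"
      then have e: "e \<subseteq> V" "card e = 2" "pairwise A e" "v \<in> e" by (auto simp: cliques_def)
      then obtain w where "e = {v, w}" "v \<noteq> w"
        by (auto simp: card_2_iff)
      then show "e \<in> (\<lambda>w. {v, w}) ` common {v}"
        using e by (auto simp: common_def pairwise_def)
    next
      fix e assume "e \<in> (\<lambda>w. {v, w}) ` common {v}"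
      then obtain w where "e = {v, w}" "w \<in> V" "A v w" by (auto simp: common_def)
      moreover have "v \<noteq> w" using \<open>A v w\<close> irrA by (auto dest: irreflpD)
      ultimately show "e \<in> {e \<in> cliques A V 2. v \<in> e}"
        using that symA by (auto simp: cliques_def pairwise_def dest: sympD)
    qed
    moreover have "inj_on (\<lambda>w. {v, w}) (common {v})"
      by (auto simp: inj_on_def doubleton_eq_iff)
    ultimately show ?thesis by (simp add: card_image)
  qed
  then have "(\<Sum>v\<in>V. card (common {v})) = (\<Sum>v\<in>V. card {e \<in> cliques A V 2. v \<in> e})"
    by simp
  also have "\<dots> = 2 * card (cliques A V 2)"
  proof (intro sum_multicount ballI finV finite_cliques)
    fix e assume "e \<in> cliques A V 2"
    then have "{v \<in> V. v \<in> e} = e" "card e = 2" by (auto simp: cliques_def)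
    then show "card {v \<in> V. v \<in> e} = 2" by simp
  qed
  finally show ?thesis .
qed

text \<open>By symmetry, \<open>S\<close> lies in the common neighbourhood of \<open>x\<close> and
  \<open>y\<close> iff both \<open>x\<close> and \<open>y\<close> lie in \<open>common S\<close>.
  The pairs are ordered and may have \<open>x = y\<close>, hence the exact square.\<close>

lemma sum_card_inside_common_pair:
  assumes "finite F" "\<And>S. S \<in> F \<Longrightarrow> S \<subseteq> V"
  shows "(\<Sum>(x, y)\<in>V \<times> V. card {S \<in> F. S \<subseteq> common {x, y}}) = (\<Sum>S\<in>F. (card (common S))\<^sup>2)"
proof -
  have "(\<Sum>p\<in>V \<times> V. card {S \<in> F. S \<subseteq> common {fst p, snd p}}) = (\<Sum>S\<in>F. (card (common S))\<^sup>2)"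
  proof (intro sum_multicount_gen ballI)
    fix S assume "S \<in> F"
    then have "{p \<in> V \<times> V. S \<subseteq> common {fst p, snd p}} = common S \<times> common S"
      using assms(2) symA by (fastforce simp: common_def dest: sympD)
    then show "card {p \<in> V \<times> V. S \<subseteq> common {fst p, snd p}} = (card (common S))\<^sup>2"
      by (simp add: card_cartesian_product power2_eq_square)
  qed (use assms finV in auto)
  then show ?thesis by (simp add: case_prod_beta)
qed

text \<open>The case of singletons: the expected size of a random common neighbourhood is governed
  by the second moment of the degrees.\<close>

lemma sum_card_common_pair:
  "(\<Sum>(x, y)\<in>V \<times> V. card (common {x, y})) = (\<Sum>v\<in>V. (card (common {v}))\<^sup>2)"
proof -
  have "{S \<in> (\<lambda>v. {v}) ` V. S \<subseteq> common {x, y}} = (\<lambda>v. {v}) ` common {x, y}" for x y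
    using common_subset by auto
  then have "card {S \<in> (\<lambda>v. {v}) ` V. S \<subseteq> common {x, y}} = card (common {x, y})" for x y
    by (simp add: card_image)
  moreover have "finite ((\<lambda>v. {v}) ` V)" "\<And>S. S \<in> (\<lambda>v. {v}) ` V \<Longrightarrow> S \<subseteq> V"
    using finV by auto
  ultimately show ?thesis
    using sum_card_inside_common_pair[of "(\<lambda>v. {v}) ` V"] by (simp add: sum.reindex)
qed

text \<open>
  Dependent random choice: the common neighbourhood of two random vertices contains few edges,
  since no edge has many common neighbours.
\<close>
lemma independent_set_dependent_random_choice:
  fixes q :: nat and M n E :: real
  assumes cod: "\<And>e. e \<in> cliques A V 2 \<Longrightarrow> card (common e) \<le> M"
    and ne: "V \<noteq> {}" and q: "q \<ge> 1"
  defines "n \<equiv> real (card V)" and "E \<equiv> real (card (cliques A V 2))"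
  shows "\<exists>W\<subseteq>V. cliques A W 2 = {} \<and> ((2 * E)\<^sup>2 / (n * q) - E * M\<^sup>2 / q\<^sup>2) / n\<^sup>2 \<le> card W"
proof -
  define c where "c = ((2 * E)\<^sup>2 / (n * q) - E * M\<^sup>2 / q\<^sup>2) / n\<^sup>2"
  define F where "F = cliques A V 2"
  define I where "I x y = {S \<in> F. S \<subseteq> common {x, y}}" for x y
  have n0: "n > 0" using ne finV by (simp add: n_def card_gt_0_iff)
  have "2 * E = (\<Sum>v\<in>V. real (card (common {v})))"
    using arg_cong[OF sum_degree, of real] by (simp add: E_def)
  \<comment> \<open>Cauchy-Schwarz for the degree sequence.\<close>
  then have "(2 * E)\<^sup>2 \<le> (\<Sum>v\<in>V. (real (card (common {v})))\<^sup>2) * n"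
    using sum_squared_le_sum_of_squares unfolding n_def by simp
  also have "(\<Sum>v\<in>V. (real (card (common {v})))\<^sup>2) = (\<Sum>(x, y)\<in>V \<times> V. real (card (common {x, y})))"
    using arg_cong[OF sum_card_common_pair, of real] by (simp add: case_prod_beta)
  finally have U: "(2 * E)\<^sup>2 / n \<le> (\<Sum>(x, y)\<in>V \<times> V. real (card (common {x, y})))"
    using n0 by (simp add: divide_le_eq)
  have "(\<Sum>(x, y)\<in>V \<times> V. card (I x y)) = (\<Sum>S\<in>F. (card (common S))\<^sup>2)"
    unfolding I_def by (rule sum_card_inside_common_pair) (auto simp: F_def cliques_def finV)
  then have "(\<Sum>(x, y)\<in>V \<times> V. real (card (I x y))) = (\<Sum>S\<in>F. (real (card (common S)))\<^sup>2)"
    by (simp add: case_prod_beta flip: of_nat_sum of_nat_power)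
  also have "\<dots> \<le> (\<Sum>S\<in>F. M\<^sup>2)"
    using cod by (intro sum_mono power_mono) (auto simp: F_def)
  finally have B: "(\<Sum>(x, y)\<in>V \<times> V. real (card (I x y))) \<le> E * M\<^sup>2"
    by (simp add: F_def E_def)
  \<comment> \<open>The quantity averaged over the pairs is what the deletion method with density
    \<open>1 / q\<close> guarantees inside \<open>common {x, y}\<close>. One pair is thus good for
    vertices and edges at once.\<close>
  have "c * card (V \<times> V) = (2 * E)\<^sup>2 / n / q - E * M\<^sup>2 / q\<^sup>2"
    using n0 by (simp add: c_def n_def[symmetric] card_cartesian_product power2_eq_square)
  also have "\<dots> \<le> (\<Sum>(x, y)\<in>V \<times> V. real (card (common {x, y}))) / q
      - (\<Sum>(x, y)\<in>V \<times> V. real (card (I x y))) / q\<^sup>2"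
    by (intro diff_mono divide_right_mono U B) auto
  also have "\<dots> = (\<Sum>p\<in>V \<times> V. real (card (common {fst p, snd p})) / q
      - real (card (I (fst p) (snd p))) / q\<^sup>2)"
    by (simp add: case_prod_beta sum_subtractf sum_divide_distrib)
  finally have "\<exists>p\<in>V \<times> V. c \<le> real (card (common {fst p, snd p})) / q
      - real (card (I (fst p) (snd p))) / q\<^sup>2"
    using ne finV by (intro exists_ge_average) auto
  then obtain x y where xy: "c \<le> real (card (common {x, y})) / q - real (card (I x y)) / q\<^sup>2"
    by auto
  obtain W where W: "W \<subseteq> common {x, y}" "\<forall>S\<in>I x y. \<not> S \<subseteq> W"
      "real (card (common {x, y})) / q - real (card (I x y)) / q\<^sup>2 \<le> card W"
    using sparse_family_free_subset[of "common {x, y}" "I x y" 2 q] q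
    by (auto simp: I_def F_def cliques_def)
  show ?thesis
  proof (intro exI conjI)
    show "W \<subseteq> V" using W common_subset by blast
    show "cliques A W 2 = {}"
      using W(1,2) common_subset[of "{x, y}"] unfolding I_def F_def cliques_def by blast
    show "((2 * E)\<^sup>2 / (n * q) - E * M\<^sup>2 / q\<^sup>2) / n\<^sup>2 \<le> card W"
      using xy W(3) unfolding c_def by linarith
  qed
qed

lemma triangle_free_set_few_edges:
  fixes q :: nat and M :: real
  assumes "\<And>e. e \<in> cliques A V 2 \<Longrightarrow> card (common e) \<le> M" and q: "q \<ge> 1"
  shows "\<exists>W\<subseteq>V. cliques A W 3 = {} \<and>
    real (card V) / q - card (cliques A V 2) * M / q ^ 3 \<le> card W"
proof -
  obtain W where W: "W \<subseteq> V" "\<forall>S\<in>cliques A V 3. \<not> S \<subseteq> W"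
      "real (card V) / q - real (card (cliques A V 3)) / q ^ 3 \<le> card W"
    using sparse_family_free_subset[of V "cliques A V 3" 3 q] finV q
    by (auto simp: cliques_def)
  have "real (card (cliques A V 3)) / q ^ 3 \<le> card (cliques A V 2) * M / q ^ 3"
    by (intro divide_right_mono card_triangles_le assms) auto
  then show ?thesis
    using W by (intro exI[of _ W]) (auto simp: cliques_def)
qed

end

section \<open>Numerical bounds for the sparse and the dense case\<close>

lemma few_edges_bound:
  fixes y E :: real and q :: nat
  assumes y: "y \<ge> 1" and E: "2 * E \<le> y ^ 21" and q: "q = nat \<lfloor>5 / 3 * y ^ 7\<rfloor>"
  shows "q \<ge> 1" and "y ^ 5 / 2 \<le> y ^ 12 / q - E * (y ^ 5 / 2) / q ^ 3"
proof -
  have y7: "y ^ 7 \<ge> 1" using y by simp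
  then have q_le: "q \<le> 5 / 3 * y ^ 7" and q_gt: "5 / 3 * y ^ 7 < q + 1"
    unfolding q by linarith+
  show q1: "q \<ge> 1" using y7 unfolding q by linarith
  \<comment> \<open>In the worst case \<open>2 * E = y ^ 21\<close> the bound becomes
    \<open>y ^ 5 * (r - r ^ 3 / 4)\<close>. Rounding down to \<open>q \<ge> 1\<close> costs at most
    a factor 2, so the constant 5/3 puts \<open>r\<close> between 3/5 and 6/5, where the bracket is
    at least 1/2.\<close>
  define r where "r = y ^ 7 / q"
  have q0: "real q \<ge> 1" using q1 by simp
  have r1: "3 / 5 \<le> r" using q_le q0 by (simp add: r_def le_divide_eq)
  have r2: "r \<le> 6 / 5" using q_gt q0 by (simp add: r_def divide_le_eq)
  \<comment> \<open>The square lies below its chord on this interval; using this twice bounds the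
    cube by a linear function of \<open>r\<close>.\<close>
  have sq: "r * r \<le> 9 / 5 * r - 18 / 25"
    using mult_nonneg_nonneg[of "r - 3 / 5" "6 / 5 - r"] r1 r2 by (simp add: algebra_simps)
  have "r ^ 3 = r * (r * r)" by (simp add: power3_eq_cube)
  also have "\<dots> \<le> r * (9 / 5 * r - 18 / 25)" using sq r1 by (intro mult_left_mono) auto
  also have "\<dots> = 9 / 5 * (r * r) - 18 / 25 * r" by (simp add: algebra_simps)
  finally have "1 / 2 \<le> r - r ^ 3 / 4" using sq r1 by linarith
  then have "y ^ 5 * (1 / 2) \<le> y ^ 5 * (r - r ^ 3 / 4)" using y by (intro mult_left_mono) auto
  also have "\<dots> = y ^ 12 / q - (y ^ 21 / 2) * (y ^ 5 / 2) / q ^ 3"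
    using q0 by (simp add: r_def power_divide field_simps flip: power_add power_mult)
  also have "\<dots> \<le> y ^ 12 / q - E * (y ^ 5 / 2) / q ^ 3"
    using E y by (intro diff_left_mono divide_right_mono mult_right_mono) auto
  finally show "y ^ 5 / 2 \<le> y ^ 12 / q - E * (y ^ 5 / 2) / q ^ 3" by simp
qed

text \<open>With \<open>r = y / q\<close> and \<open>a = 2 * E / y ^ 21\<close> the right-hand side
  is \<open>y ^ 5 * ((r * a) * (a - r / 8))\<close>. Here \<open>a \<ge> 1\<close>, and rounding
  gives \<open>1 \<le> r \<le> 2\<close>, so the first factor is at least 1 and the second at least
  3/4.\<close>

lemma many_edges_bound:
  fixes y E :: real and q :: nat
  assumes y: "y \<ge> 1" and E: "2 * E \<ge> y ^ 21" and q: "q = nat \<lfloor>y\<rfloor>"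
  shows "q \<ge> 1"
    and "y ^ 5 / 2 \<le> ((2 * E)\<^sup>2 / (y ^ 12 * q) - E * (y ^ 5 / 2)\<^sup>2 / q\<^sup>2) / (y ^ 12)\<^sup>2"
proof -
  have q_le: "q \<le> y" and q_gt: "y < q + 1"
    using y unfolding q by linarith+
  show q1: "q \<ge> 1" using y unfolding q by linarith
  define r where "r = y / q"
  define a where "a = 2 * E / y ^ 21"
  have q0: "real q \<ge> 1" using q1 by simp
  have r1: "1 \<le> r" using q_le q0 by (simp add: r_def le_divide_eq)
  have r2: "r \<le> 2" using q_gt q0 by (simp add: r_def divide_le_eq)
  have a1: "1 \<le> a" using E y by (simp add: a_def le_divide_eq)
  have E_eq: "E = a * y ^ 21 / 2" using y by (simp add: a_def)
  have "1 * (1 / 2) \<le> (r * a) * (a - r / 8)"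
    using r1 r2 a1 mult_mono[of 1 r 1 a] by (intro mult_mono) auto
  then have "y ^ 5 * (1 / 2) \<le> y ^ 5 * ((r * a) * (a - r / 8))"
    using y by (intro mult_left_mono) auto
  also have "\<dots> = ((2 * E)\<^sup>2 / (y ^ 12 * q) - E * (y ^ 5 / 2)\<^sup>2 / q\<^sup>2) / (y ^ 12)\<^sup>2"
  proof -
    \<comment> \<open>The numerators contain \<open>y ^ 42\<close> and \<open>y ^ 31\<close>, where
      42 = 6 + 12 + 24 and 31 = 7 + 24; with \<open>Y\<close> opaque its powers simply
      cancel.\<close>
    define Y where "Y = y ^ 12"
    have "(2 * E)\<^sup>2 = a\<^sup>2 * y ^ 6 * (Y * Y\<^sup>2)" and "E * (y ^ 5 / 2)\<^sup>2 = a * y ^ 7 / 8 * Y\<^sup>2"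
      by (simp_all add: E_eq Y_def power_mult_distrib power_divide flip: power_add power_mult)
    note num = this
    have "Y > 0" using y by (simp add: Y_def)
    then have "((2 * E)\<^sup>2 / (Y * q) - E * (y ^ 5 / 2)\<^sup>2 / q\<^sup>2) / Y\<^sup>2
        = a\<^sup>2 * y ^ 6 / q - a * y ^ 7 / 8 / q\<^sup>2"
      unfolding num by (simp add: diff_divide_distrib)
    also have "\<dots> = y ^ 5 * ((r * a) * (a - r / 8))"
      by (simp add: r_def algebra_simps power2_eq_square eval_nat_numeral)
    finally show ?thesis by (simp add: Y_def)
  qed
  finally show "y ^ 5 / 2 \<le> ((2 * E)\<^sup>2 / (y ^ 12 * q) - E * (y ^ 5 / 2)\<^sup>2 / q\<^sup>2) / (y ^ 12)\<^sup>2"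
    by simp
qed

lemma (in adjacency) large_triangle_free_set:
  assumes K5: "cliques A V 5 = {}"
  shows "\<exists>W\<subseteq>V. cliques A W 3 = {} \<and> real (card V) powr (5 / 12) / 2 \<le> card W"
\<comment> \<open>The empty graph is separate: \<open>y \<ge> 1\<close> and the choice of random
  vertices require a vertex.\<close>
proof (cases "V = {}")
  case True
  then show ?thesis by (auto simp: cliques_def)
next
  case False
  define y where "y = real (card V) powr (1 / 12)"
  have n1: "real (card V) \<ge> 1" using False finV by (simp add: Suc_le_eq card_gt_0_iff)
  then have y1: "y \<ge> 1" by (simp add: y_def ge_one_powr_ge_zero)
  have y5: "real (card V) powr (5 / 12) = y ^ 5" and y12: "real (card V) = y ^ 12"
    using n1 by (simp_all add: y_def powr_power)
  show ?thesis
  proof (rule ccontr)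
    assume "\<not> ?thesis"
    \<comment> \<open>This serves twice: it bounds the common neighbourhoods of edges, and it
      contradicts the set constructed in either case.\<close>
    then have small: "card W < y ^ 5 / 2" if "W \<subseteq> V" "cliques A W 3 = {}" for W
      using that by (auto simp: y5 not_le)
    have cod: "card (common e) \<le> y ^ 5 / 2" if "e \<in> cliques A V 2" for e
      using small[OF common_subset] clique_Un_common[OF that] K5 by fastforce
    show False
    \<comment> \<open>As \<open>n = y ^ 12\<close>, the threshold is average degree
      \<open>y ^ 9\<close>.\<close>
    proof (cases "2 * real (card (cliques A V 2)) \<le> y ^ 21")
      case True
      note bound = few_edges_bound[OF y1 True refl]
      obtain W where "W \<subseteq> V" "cliques A W 3 = {}"
        and W: "y ^ 12 / nat \<lfloor>5 / 3 * y ^ 7\<rfloor>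
          - card (cliques A V 2) * (y ^ 5 / 2) / nat \<lfloor>5 / 3 * y ^ 7\<rfloor> ^ 3 \<le> card W"
        using triangle_free_set_few_edges[OF cod bound(1)] unfolding y12 by metis
      then show False using order_trans[OF bound(2) W] small[of W] by simp
    next
      case few: False
      then have "2 * real (card (cliques A V 2)) \<ge> y ^ 21" by simp
      note bound = many_edges_bound[OF y1 this refl]
      obtain W where "W \<subseteq> V" "cliques A W 2 = {}"
        and W: "((2 * real (card (cliques A V 2)))\<^sup>2 / (y ^ 12 * nat \<lfloor>y\<rfloor>)
          - card (cliques A V 2) * (y ^ 5 / 2)\<^sup>2 / (nat \<lfloor>y\<rfloor>)\<^sup>2) / (y ^ 12)\<^sup>2 \<le> card W"
        using independent_set_dependent_random_choice[OF cod False bound(1)]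
        unfolding y12 by metis
      moreover have "cliques A W 3 = {}"
        using clique_subset_exists[of _ W 3 2] \<open>cliques A W 2 = {}\<close> by auto
      ultimately show False using order_trans[OF bound(2) W] small[of W] by simp
    qed
  qed
qed

section \<open>Transfer to the digraph encoding of graphs\<close>

lemma (in graph) adjacency_arcs: "adjacency (verts G) (\<lambda>u v. u \<rightarrow>\<^bsub>G\<^esub> v)"
proof
  show "symp (\<lambda>u v. u \<rightarrow>\<^bsub>G\<^esub> v)"
    using sym_arcs by (auto simp: symmetric_def symp_def dest: symD)
  show "irreflp (\<lambda>u v. u \<rightarrow>\<^bsub>G\<^esub> v)"
    by (auto simp: irreflp_def dest: adj_not_same)
qed simp

text \<open>The subgraph induced by a clique has as arc ends exactly the ordered pairs of distinct
  vertices, so it is a complete digraph inside \<open>G\<close>.\<close>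

lemma (in graph) complete_free_imp_no_cliques:
  assumes "complete_free k G"
  shows "cliques (\<lambda>u v. u \<rightarrow>\<^bsub>G\<^esub> v) (verts G) k = {}"
proof (rule ccontr)
  assume "\<not> ?thesis"
  then obtain K where K: "K \<subseteq> verts G" "card K = k" "pairwise (\<lambda>u v. u \<rightarrow>\<^bsub>G\<^esub> v) K"
    by (auto simp: cliques_def)
  have ends: "arcs_ends (G \<restriction> K) = {(u, v). (u, v) \<in> K \<times> K \<and> u \<noteq> v}"
    using K(3) no_loops by (fastforce simp: arcs_ends_conv pairwise_def)
  interpret H: digraph "G \<restriction> K"
    by (rule digraphI_induced[OF induced_induce[OF K(1)]])
  have "graph (G \<restriction> K)"
    by unfold_locales (auto simp: symmetric_def ends sym_def)
  then have "complete_digraph k (G \<restriction> K)"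
    using K ends by (simp add: complete_digraph_def)
  moreover have "subgraph (G \<restriction> K) G" using K by (rule_tac subgraph_induce_subgraphI)
  ultimately show False using assms by (auto simp: complete_free_def)
qed

text \<open>Arcs of a complete subgraph are also arcs of \<open>G\<close>, so its vertex set alone
  is already a clique in \<open>W\<close>.\<close>

lemma (in graph) no_cliques_imp_complete_free:
  assumes "cliques (\<lambda>u v. u \<rightarrow>\<^bsub>G\<^esub> v) W k = {}"
  shows "complete_free k (G \<restriction> W)"
  unfolding complete_free_def
proof (intro notI, elim exE conjE)
  fix H assume H: "subgraph H (G \<restriction> W)" "complete_digraph k H"
  have "u \<rightarrow>\<^bsub>G\<^esub> v" if "u \<in> verts H" "v \<in> verts H" "u \<noteq> v" for u v
  proof -
    have "(u, v) \<in> arcs_ends H" using H(2) that by (auto simp: complete_digraph_def)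
    then have "(u, v) \<in> arcs_ends (G \<restriction> W)"
      by (rule pre_digraph.adj_mono[OF _ H(1)])
    then show ?thesis by (rule dominates_induce_subgraphD)
  qed
  then have "verts H \<in> cliques (\<lambda>u v. u \<rightarrow>\<^bsub>G\<^esub> v) W k"
    using H by (auto simp: cliques_def complete_digraph_def pairwise_def subgraph_def)
  with assms show False by simp
qed

theorem theorem9p2:
  fixes G :: "('a, 'b) pre_digraph" and n :: nat
  assumes "graph G"
    and "card (verts G) = n"
    and "complete_free 5 G"
  shows "\<exists>H. induced_subgraph H G \<and> triangle_free H
           \<and> real (card (verts H)) \<ge> real n powr (5 / 12) / 2"
proof -
  interpret graph G by fact
  interpret adj: adjacency "verts G" "\<lambda>u v. u \<rightarrow>\<^bsub>G\<^esub> v" by (rule adjacency_arcs)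
  obtain W where "W \<subseteq> verts G" "cliques (\<lambda>u v. u \<rightarrow>\<^bsub>G\<^esub> v) W 3 = {}"
      "real n powr (5 / 12) / 2 \<le> card W"
    using adj.large_triangle_free_set complete_free_imp_no_cliques assms by blast
  then show ?thesis
    using no_cliques_imp_complete_free by (intro exI[of _ "G \<restriction> W"]) auto
qed

end
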